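(* Let $p_1,\dots,p_8$ be a proper Poncelet octagon with circumscribed non-degenerate conic $\mathcal{A}$ (in the projective plane over $\mathbb{K}\in\{\mathbb{R},\mathbb{C}\}$). Then, with respect to a parametrization of $\mathcal{A}$ by $\mathbb{KP}^1$, \[[12][14][27][34][35][57]=[13][17][23][25][45][47].\]
   Context: Poncelet chains: given conics $\mathcal{A}$ (outer) and $\mathcal{B}$ (inner), a Poncelet chain is a sequence $p_1,p_2,\dots$ of points on $\mathcal{A}$ obtained as follows: $l_1$ is a tangent to $\mathcal{B}$ through $p_1$; $p_{i+1}$ is the intersection of $l_i$ with $\mathcal{A}$ other than $p_i$; $l_{i+1}$ is the tangent to $\mathcal{B}$ through $p_{i+1}$ other than $l_i$. If the chain closes after $8$ steps ($p_{i+8}=p_i$ for all $i$), then $p_1,\dots,p_8$ is a Poncelet octagon; it is proper if its eight points are distinct. Bracket notation: fix a projective parametrization of $\mathcal{A}$ by $\mathbb{KP}^1$ (e.g. via stereographic projection from a point of $\mathcal{A}$), so each $p_i$ has homogeneous coordinates $v_i\in\mathbb{K}^2\setminus\{0\}$; writing $p_i$ as $i$, $[ij]:=\det(v_i,v_j)$. The equation is multihomogeneous and independent of the choices made. *)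

theory Defs
  imports "HOL-Analysis.Analysis"
begin

text \<open>
  The ground field is a type of class \<open>real_normed_field\<close>: by the Gelfand-Mazur theorem its
  instances are, up to isomorphism, exactly \<open>real\<close> and \<open>complex\<close>.

  Points and lines of the projective plane are given by nonzero homogeneous coordinate vectors
  in \<open>'a ^ 3\<close>, points of the projective line by nonzero vectors in \<open>'a ^ 2\<close>; equality of
  projective objects is \<open>proj_eq\<close>.
\<close>

definition proj_eq :: "'a::field ^ 'n \<Rightarrow> 'a ^ 'n \<Rightarrow> bool" where
  "proj_eq x y \<longleftrightarrow> (\<exists>c. c \<noteq> 0 \<and> y = c *s x)"

definition incident :: "'a::field ^ 3 \<Rightarrow> 'a ^ 3 \<Rightarrow> bool" where
  "incident x l \<longleftrightarrow> x \<noteq> 0 \<and> l \<noteq> 0 \<and> scalar_product l x = 0"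

text \<open>A conic is the zero set of a nonzero quadratic form, given by its symmetric matrix.\<close>

definition is_conic :: "'a::field ^ 3 ^ 3 \<Rightarrow> bool" where
  "is_conic A \<longleftrightarrow> A \<noteq> 0 \<and> transpose A = A"

definition nondegenerate_conic :: "'a::field ^ 3 ^ 3 \<Rightarrow> bool" where
  "nondegenerate_conic A \<longleftrightarrow> is_conic A \<and> invertible A"

definition on_conic :: "'a::field ^ 3 ^ 3 \<Rightarrow> 'a ^ 3 \<Rightarrow> bool" where
  "on_conic A x \<longleftrightarrow> x \<noteq> 0 \<and> scalar_product x (A *v x) = 0"

text \<open>
  The tangent at a point \<open>q\<close> of \<open>B\<close> is the line whose coordinates are the gradient
  \<open>2 (B *v q)\<close> of the quadratic form at \<open>q\<close>; it exists iff \<open>q\<close> is not a singular point of \<open>B\<close>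
  (always the case if \<open>B\<close> is nondegenerate).
\<close>

definition tangent_line :: "'a::field ^ 3 ^ 3 \<Rightarrow> 'a ^ 3 \<Rightarrow> bool" where
  "tangent_line B l \<longleftrightarrow> l \<noteq> 0 \<and> (\<exists>q. on_conic B q \<and> proj_eq l (B *v q))"

text \<open>
  Sequences are indexed from 1. ``Other than'' is read strictly. Under the reading with
  multiplicities (\<open>p (i+1) = p i\<close> if \<open>l i\<close> touches \<open>A\<close> at \<open>p i\<close>, and \<open>l (i+1) = l i\<close> if \<open>p (i+1)\<close>
  lies on \<open>B\<close>, which forces \<open>p (i+2) = p i\<close>), the additional chains repeat a point within two
  steps, so the proper octagons are the same.
\<close>

definition poncelet_chain ::
  "'a::field ^ 3 ^ 3 \<Rightarrow> 'a ^ 3 ^ 3 \<Rightarrow> (nat \<Rightarrow> 'a ^ 3) \<Rightarrow> bool" where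
  "poncelet_chain A B p \<longleftrightarrow>
    (\<exists>l. \<forall>i\<ge>1. on_conic A (p i) \<and> tangent_line B (l i) \<and> incident (p i) (l i) \<and>
        incident (p (i + 1)) (l i) \<and> \<not> proj_eq (p (i + 1)) (p i) \<and>
        \<not> proj_eq (l (i + 1)) (l i))"

definition poncelet_octagon ::
  "'a::field ^ 3 ^ 3 \<Rightarrow> 'a ^ 3 ^ 3 \<Rightarrow> (nat \<Rightarrow> 'a ^ 3) \<Rightarrow> bool" where
  "poncelet_octagon A B p \<longleftrightarrow>
    poncelet_chain A B p \<and> (\<forall>i\<ge>1. proj_eq (p (i + 8)) (p i))"

definition proper_poncelet_octagon ::
  "'a::field ^ 3 ^ 3 \<Rightarrow> 'a ^ 3 ^ 3 \<Rightarrow> (nat \<Rightarrow> 'a ^ 3) \<Rightarrow> bool" where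
  "proper_poncelet_octagon A B p \<longleftrightarrow>
    poncelet_octagon A B p \<and>
    (\<forall>i\<in>{1..8}. \<forall>j\<in>{1..8}. i \<noteq> j \<longrightarrow> \<not> proj_eq (p i) (p j))"

text \<open>
  A projective parametrization of a conic by the projective line: a map given by binary quadratic
  forms that induces a bijection onto the points of the conic. The inverse of a stereographic
  projection from a point of the conic to a line is of this form.
\<close>

definition conic_parametrization ::
  "'a::field ^ 3 ^ 3 \<Rightarrow> ('a ^ 2 \<Rightarrow> 'a ^ 3) \<Rightarrow> bool" where
  "conic_parametrization A \<phi> \<longleftrightarrow>
    (\<exists>a b c. \<forall>v. \<phi> v = (v $ 1)\<^sup>2 *s a + (v $ 1 * v $ 2) *s b + (v $ 2)\<^sup>2 *s c) \<and>
    (\<forall>v. v \<noteq> 0 \<longrightarrow> on_conic A (\<phi> v)) \<and>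
    (\<forall>v w. v \<noteq> 0 \<longrightarrow> w \<noteq> 0 \<longrightarrow> proj_eq (\<phi> v) (\<phi> w) \<longrightarrow> proj_eq v w) \<and>
    (\<forall>x. on_conic A x \<longrightarrow> (\<exists>v. v \<noteq> 0 \<and> proj_eq (\<phi> v) x))"

definition bracket :: "'a::field ^ 2 \<Rightarrow> 'a ^ 2 \<Rightarrow> 'a" where
  "bracket v w = det (vector [v, w] :: 'a ^ 2 ^ 2)"

end

(*
  The condition that the chord joining two points of A touches B is, in terms of the parameters
  v, w of the two points, a symmetric equation F(v, w) = 0 that is quadratic in each argument.
  For an octagon with parameters v_1, ..., v_8, the binary quadratic form F(v_i, -) vanishes at
  v_(i-1) and v_(i+1), so F(v_i, w) = c_i [w, v_(i-1)] [w, v_(i+1)]. Symmetry of F gives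
    c_i [j, i-1] [j, i+1] = c_j [i, j-1] [i, j+1]   for all i, j modulo 8,
  and the theorem is a product of nine of these relations and their inverses. To cancel, all
  c_i have to be nonzero: if one of them vanishes, then all do, so F = 0, hence the dual conic
  of B is zero and B has no tangents.
*)
theory Submission
  imports Defs
begin

section \<open>Brackets and binary quadratic forms\<close>

lemma bracket_eq: "bracket v w = v$1 * w$2 - v$2 * w$1"
  by (simp add: bracket_def det_2)

lemma bracket_skew: "bracket w v = - bracket v w"
  by (simp add: bracket_eq algebra_simps)

lemma bracket_eq_0_imp_proj_eq:
  assumes "v \<noteq> 0" "w \<noteq> 0" "bracket v w = 0"
  shows "proj_eq v w"
proof (cases "v$1 = 0")
  case True
  with assms have "v$2 \<noteq> 0" "w$1 = 0" "w$2 \<noteq> 0"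
    by (auto simp: bracket_eq vec_eq_iff forall_2)
  with True show ?thesis
    unfolding proj_eq_def by (intro exI[of _ "w$2 / v$2"]) (simp add: vec_eq_iff forall_2)
next
  case False
  with assms have "w$1 \<noteq> 0"
    by (auto simp: bracket_eq vec_eq_iff forall_2)
  with False assms(3) show ?thesis
    unfolding proj_eq_def
    by (intro exI[of _ "w$1 / v$1"]) (simp add: vec_eq_iff forall_2 bracket_eq field_simps)
qed

definition binary_quadratic :: "('a::field ^ 2 \<Rightarrow> 'a) \<Rightarrow> bool" where
  "binary_quadratic f \<longleftrightarrow> (\<exists>a b c. \<forall>w. f w = a * (w$1)\<^sup>2 + b * (w$1 * w$2) + c * (w$2)\<^sup>2)"

text \<open>Applying \<open>f\<close> to Cramer's rule [x,y] w = [w,y] x - [w,x] y leaves only the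
  mixed term once \<open>f x\<close> and \<open>f y\<close> vanish. The constant \<open>m\<close> is
  the polar form f(x + y) - f(x) - f(y).\<close>

lemma binary_quadratic_factor:
  fixes f :: "'a::field ^ 2 \<Rightarrow> 'a"
  assumes "binary_quadratic f" "f x = 0" "f y = 0" "bracket x y \<noteq> 0"
  shows "\<exists>k. \<forall>w. f w = k * bracket w x * bracket w y"
proof -
  from assms(1) obtain a b c where f: "f w = a * (w$1)\<^sup>2 + b * (w$1 * w$2) + c * (w$2)\<^sup>2" for w
    by (auto simp: binary_quadratic_def)
  define m where "m = 2 * a * x$1 * y$1 + b * (x$1 * y$2 + x$2 * y$1) + 2 * c * x$2 * y$2"
  have "f w * (bracket x y)\<^sup>2 = - m * bracket w x * bracket w y" for w
  proof -
    have "f w * (bracket x y)\<^sup>2 =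
      (bracket w y)\<^sup>2 * f x + (bracket w x)\<^sup>2 * f y - m * bracket w x * bracket w y"
      unfolding f m_def bracket_eq by algebra
    then show ?thesis by (simp add: assms)
  qed
  then have "f w = (- m / (bracket x y)\<^sup>2) * bracket w x * bracket w y" for w
    using assms(4) by (simp add: field_simps)
  then show ?thesis by blast
qed

lemma binary_quadratic_eq_0:
  fixes f :: "'a::field ^ 2 \<Rightarrow> 'a"
  assumes "binary_quadratic f" "f x = 0" "f y = 0" "f z = 0"
    and "bracket x y \<noteq> 0" "bracket z x \<noteq> 0" "bracket z y \<noteq> 0"
  shows "f w = 0"
proof -
  obtain k where k: "\<And>w. f w = k * bracket w x * bracket w y"
    using binary_quadratic_factor[OF assms(1,2,3,5)] by blast
  with assms have "k = 0" by auto
  with k show ?thesis by simp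
qed

section \<open>Symmetric biquadratic forms vanishing on the sides of an octagon\<close>

definition octagon_succ :: "nat \<Rightarrow> nat" where
  "octagon_succ i = (if i = 8 then 1 else i + 1)"

definition octagon_pred :: "nat \<Rightarrow> nat" where
  "octagon_pred i = (if i = 1 then 8 else i - 1)"

lemma octagon_indices: "{1..8::nat} = {1, 2, 3, 4, 5, 6, 7, 8}"
  by auto

lemma symmetric_biquadratic_octagon:
  fixes F :: "'a::field ^ 2 \<Rightarrow> 'a ^ 2 \<Rightarrow> 'a" and v :: "nat \<Rightarrow> 'a ^ 2"
  assumes sym: "\<And>x y. F x y = F y x"
    and quad: "\<And>x. binary_quadratic (F x)"
    and nonzero: "F x0 y0 \<noteq> 0"
    and distinct: "\<And>i j. i \<in> {1..8} \<Longrightarrow> j \<in> {1..8} \<Longrightarrow> i \<noteq> j \<Longrightarrow> bracket (v i) (v j) \<noteq> 0"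
    and chain: "\<And>i. i \<in> {1..8} \<Longrightarrow> F (v i) (v (octagon_succ i)) = 0"
  shows "bracket (v 1) (v 2) * bracket (v 1) (v 4) * bracket (v 2) (v 7) *
         bracket (v 3) (v 4) * bracket (v 3) (v 5) * bracket (v 5) (v 7) =
         bracket (v 1) (v 3) * bracket (v 1) (v 7) * bracket (v 2) (v 3) *
         bracket (v 2) (v 5) * bracket (v 4) (v 5) * bracket (v 4) (v 7)"
proof -
  define b where "b i j = bracket (v i) (v j)" for i j
  have b_nz: "b i j \<noteq> 0" if "i \<in> {1..8}" "j \<in> {1..8}" "i \<noteq> j" for i j
    using distinct[OF that] by (simp add: b_def)
  have pred: "F (v i) (v (octagon_pred i)) = 0" if "i \<in> {1..8}" for i
  proof -
    have "octagon_pred i \<in> {1..8}" "octagon_succ (octagon_pred i) = i"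
      using that by (auto simp: octagon_pred_def octagon_succ_def)
    then show ?thesis using chain[of "octagon_pred i"] sym by metis
  qed
  have "\<exists>k. \<forall>w. F (v i) w = k * bracket w (v (octagon_pred i)) * bracket w (v (octagon_succ i))"
    if "i \<in> {1..8}" for i
    using that quad pred chain
    by (intro binary_quadratic_factor distinct) (auto simp: octagon_pred_def octagon_succ_def)
  then obtain c where c: "\<And>i w. i \<in> {1..8} \<Longrightarrow>
      F (v i) w = c i * bracket w (v (octagon_pred i)) * bracket w (v (octagon_succ i))"
    by metis
  have rel: "c i * b j (octagon_pred i) * b j (octagon_succ i) =
             c j * b i (octagon_pred j) * b i (octagon_succ j)"
    if "i \<in> {1..8}" "j \<in> {1..8}" for i j
    using c[OF that(1), of "v j"] c[OF that(2), of "v i"] sym[of "v i" "v j"]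
    by (simp add: b_def)
  \<comment> \<open>Here \<open>rel\<close> reads 0 = \<open>c j\<close> times two brackets, which
    are nonzero because \<open>i\<close> is not a neighbour of \<open>j\<close>.\<close>
  have spread: "c j = 0" if "c i = 0" "i \<in> {1..8}" "j \<in> {1..8}"
      "j \<noteq> i" "j \<noteq> octagon_succ i" "j \<noteq> octagon_pred i" for i j
  proof -
    have "octagon_pred j \<in> {1..8}" "octagon_succ j \<in> {1..8}"
      "i \<noteq> octagon_pred j" "i \<noteq> octagon_succ j"
      using that by (auto simp: octagon_succ_def octagon_pred_def split: if_splits)
    then have "b i (octagon_pred j) \<noteq> 0" "b i (octagon_succ j) \<noteq> 0"
      using b_nz \<open>i \<in> {1..8}\<close> by blast+
    then show ?thesis using rel[of i j] that by simp
  qed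
  have c_nz: "c i \<noteq> 0" if i: "i \<in> {1..8}" for i
  proof
    assume "c i = 0"
    \<comment> \<open>Any two vertices have a common non-neighbour, so two applications of \<open>spread\<close> suffice.\<close>
    have "c j = 0" if j: "j \<in> {1..8}" for j
    proof -
      have "\<exists>k\<in>{1..8}. k \<noteq> i \<and> k \<noteq> octagon_succ i \<and> k \<noteq> octagon_pred i \<and>
          j \<noteq> k \<and> j \<noteq> octagon_succ k \<and> j \<noteq> octagon_pred k"
        using i j unfolding octagon_indices
        by (elim insertE emptyE; simp add: octagon_succ_def octagon_pred_def)
      then show ?thesis using spread \<open>c i = 0\<close> i j by metis
    qed
    then have "F (v j) w = 0" if "j \<in> {1..8}" for j w
      using that c by simp
    \<comment> \<open>By symmetry the quadratic form \<open>F x0\<close> has three distinct zeros,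
      so it vanishes identically, contradicting \<open>nonzero\<close>.\<close>
    then have "F w (v 1) = 0" "F w (v 2) = 0" "F w (v 3) = 0" for w
      by (simp_all add: sym[of w])
    then have "F x0 y0 = 0"
      using binary_quadratic_eq_0[OF quad, of x0 "v 1" "v 2" "v 3"] distinct by simp
    then show False using nonzero by simp
  qed
  have eqs:
    "c 1 * b 3 8 * b 3 2 = c 3 * b 1 2 * b 1 4"
    "c 1 * b 4 8 * b 4 2 = c 4 * b 1 3 * b 1 5"
    "c 1 * b 5 8 * b 5 2 = c 5 * b 1 4 * b 1 6"
    "c 1 * b 6 8 * b 6 2 = c 6 * b 1 5 * b 1 7"
    "c 2 * b 5 1 * b 5 3 = c 5 * b 2 4 * b 2 6"
    "c 2 * b 6 1 * b 6 3 = c 6 * b 2 5 * b 2 7"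
    "c 3 * b 5 2 * b 5 4 = c 5 * b 3 4 * b 3 6"
    "c 4 * b 8 3 * b 8 5 = c 8 * b 4 7 * b 4 1"
    "c 5 * b 8 4 * b 8 6 = c 8 * b 5 7 * b 5 1"
    using rel[of 1 3] rel[of 1 4] rel[of 1 5] rel[of 1 6] rel[of 2 5] rel[of 2 6]
      rel[of 3 5] rel[of 4 8] rel[of 5 8]
    by (simp_all add: octagon_succ_def octagon_pred_def del: One_nat_def) simp_all
  \<comment> \<open>The choice of relations solves a linear system for the exponents: those for the pairs
    14, 16, 25, 48 enter with exponent 1, those for 13, 15, 26, 35, 58 with exponent -1.\<close>
  define X where "X =
      (c 3 * b 1 2 * b 1 4) *
      (c 1 * b 4 8 * b 4 2) *
      (c 5 * b 1 4 * b 1 6) *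
      (c 1 * b 6 8 * b 6 2) *
      (c 2 * b 5 1 * b 5 3) *
      (c 6 * b 2 5 * b 2 7) *
      (c 5 * b 3 4 * b 3 6) *
      (c 4 * b 8 3 * b 8 5) *
      (c 8 * b 5 7 * b 5 1)"
  have "X \<noteq> 0"
    unfolding X_def by (simp add: c_nz b_nz)
  moreover have "X * (b 1 3 * b 1 7 * b 2 3 * b 2 5 * b 4 5 * b 4 7) =
      X * (b 1 2 * b 1 4 * b 2 7 * b 3 4 * b 3 5 * b 5 7)"
  proof -
    have skew: "b i j = - b j i" if "j < i" for i j
      by (simp add: b_def bracket_skew[of "v i"])
    have "X =
      (c 1 * b 3 8 * b 3 2) *
      (c 4 * b 1 3 * b 1 5) *
      (c 1 * b 5 8 * b 5 2) *
      (c 6 * b 1 5 * b 1 7) *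
      (c 5 * b 2 4 * b 2 6) *
      (c 2 * b 6 1 * b 6 3) *
      (c 3 * b 5 2 * b 5 4) *
      (c 8 * b 4 7 * b 4 1) *
      (c 5 * b 8 4 * b 8 6)"
      by (simp only: X_def eqs)
    then have "X * (b 1 2 * b 1 4 * b 2 7 * b 3 4 * b 3 5 * b 5 7) =
      (c 1 * b 3 8 * b 3 2) *
      (c 4 * b 1 3 * b 1 5) *
      (c 1 * b 5 8 * b 5 2) *
      (c 6 * b 1 5 * b 1 7) *
      (c 5 * b 2 4 * b 2 6) *
      (c 2 * b 6 1 * b 6 3) *
      (c 3 * b 5 2 * b 5 4) *
      (c 8 * b 4 7 * b 4 1) *
      (c 5 * b 8 4 * b 8 6) *
      (b 1 2 * b 1 4 * b 2 7 * b 3 4 * b 3 5 * b 5 7)"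
      by simp
    \<comment> \<open>After sorting, both sides are the same monomial. Nine brackets on the left and
      seven in \<open>X\<close> have decreasing indices, so the signs agree.\<close>
    also have "\<dots> = X * (b 1 3 * b 1 7 * b 2 3 * b 2 5 * b 4 5 * b 4 7)"
      unfolding X_def by (simp add: skew mult_ac)
    finally show ?thesis ..
  qed
  ultimately show ?thesis by (simp add: b_def)
qed

section \<open>Joins of points and symmetric bilinear forms in homogeneous coordinates\<close>

definition vec_cross :: "'a::field ^ 3 \<Rightarrow> 'a ^ 3 \<Rightarrow> 'a ^ 3" where
  "vec_cross x y = vector [x$2 * y$3 - x$3 * y$2, x$3 * y$1 - x$1 * y$3, x$1 * y$2 - x$2 * y$1]"

lemma vec_cross_nth [simp]:
  "vec_cross x y $ 1 = x$2 * y$3 - x$3 * y$2"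
  "vec_cross x y $ 2 = x$3 * y$1 - x$1 * y$3"
  "vec_cross x y $ 3 = x$1 * y$2 - x$2 * y$1"
  by (simp_all add: vec_cross_def)

lemma scalar_product_3:
  fixes x y :: "'a::semiring_1 ^ 3"
  shows "scalar_product x y = x$1 * y$1 + x$2 * y$2 + x$3 * y$3"
  by (simp add: scalar_product_def sum_3)

lemma vec_cross_eq_0_imp_parallel:
  assumes "x \<noteq> 0" "vec_cross x y = 0"
  shows "\<exists>k. y = k *s x"
proof -
  have eqs: "x$2 * y$3 = x$3 * y$2" "x$3 * y$1 = x$1 * y$3" "x$1 * y$2 = x$2 * y$1"
    using assms(2) by (simp_all add: vec_eq_iff forall_3)
  consider "x$1 \<noteq> 0" | "x$2 \<noteq> 0" | "x$3 \<noteq> 0"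
    using assms(1) by (auto simp: vec_eq_iff forall_3)
  then show ?thesis
  proof cases
    case 1
    with eqs show ?thesis
      by (intro exI[of _ "y$1 / x$1"]) (auto simp: vec_eq_iff forall_3 field_simps)
  next
    case 2
    with eqs show ?thesis
      by (intro exI[of _ "y$2 / x$2"]) (auto simp: vec_eq_iff forall_3 field_simps)
  next
    case 3
    with eqs show ?thesis
      by (intro exI[of _ "y$3 / x$3"]) (auto simp: vec_eq_iff forall_3 field_simps)
  qed
qed

text \<open>The triple product expansion makes the cross product of \<open>l\<close> with the join
  of \<open>x\<close> and \<open>y\<close> vanish: a line through both points is their join, if the
  join exists.\<close>

lemma vec_cross_parallel_if_orthogonal:
  assumes "l \<noteq> 0" "scalar_product l x = 0" "scalar_product l y = 0"
  shows "\<exists>k. vec_cross x y = k *s l"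
proof (rule vec_cross_eq_0_imp_parallel)
  have "vec_cross l (vec_cross x y) = scalar_product l y *s x - scalar_product l x *s y"
    by (simp add: vec_eq_iff forall_3 scalar_product_3 algebra_simps)
  then show "vec_cross l (vec_cross x y) = 0"
    by (simp add: assms)
qed (rule assms(1))

lemma scalar_product_add_left: "scalar_product (x + y) z = scalar_product x z + scalar_product y z"
  by (simp add: scalar_product_def algebra_simps sum.distrib)

lemma scalar_product_add_right: "scalar_product x (y + z) = scalar_product x y + scalar_product x z"
  by (simp add: scalar_product_def algebra_simps sum.distrib)

lemma scalar_product_scale_left:
  "scalar_product (k *s x) y = k * scalar_product x (y :: 'a::comm_ring_1 ^ 'n)"
  by (simp add: scalar_product_def sum_distrib_left mult_ac)

lemma scalar_product_scale_right:
  "scalar_product x (k *s y) = k * scalar_product x (y :: 'a::comm_ring_1 ^ 'n)"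
  by (simp add: scalar_product_def sum_distrib_left mult_ac)

lemma transpose_3:
  assumes "transpose A = (A :: 'a ^ 3 ^ 3)"
  shows "A$2$1 = A$1$2" "A$3$1 = A$1$3" "A$3$2 = A$2$3"
proof -
  have "A$j$i = A$i$j" for i j
    using arg_cong[OF assms, of "\<lambda>M. M$i$j"] by (simp add: transpose_def)
  then show "A$2$1 = A$1$2" "A$3$1 = A$1$3" "A$3$2 = A$2$3" by blast+
qed

lemma matrix_vector_mult_3:
  "((A :: 'a::semiring_1 ^ 3 ^ 3) *v x) $ i = A$i$1 * x$1 + A$i$2 * x$2 + A$i$3 * x$3"
  by (simp add: matrix_vector_mult_def sum_3)

lemma scalar_product_symmetric_matrix:
  fixes A :: "'a::field ^ 3 ^ 3"
  assumes "transpose A = A"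
  shows "scalar_product x (A *v y) = scalar_product y (A *v x)"
  by (simp add: scalar_product_3 matrix_vector_mult_3 transpose_3[OF assms] algebra_simps)

lemma scalar_product_commute: "scalar_product x y = scalar_product y (x :: 'a::comm_ring_1 ^ 'n)"
  by (simp add: scalar_product_def mult.commute)

section \<open>The dual conic\<close>

text \<open>The quadratic form of the adjugate of a symmetric matrix \<open>B\<close>, with the symmetry built in.\<close>

definition dual_form :: "'a::field ^ 3 ^ 3 \<Rightarrow> 'a ^ 3 \<Rightarrow> 'a" where
  "dual_form B l =
    (B$2$2 * B$3$3 - (B$2$3)\<^sup>2) * (l$1)\<^sup>2 + (B$1$1 * B$3$3 - (B$1$3)\<^sup>2) * (l$2)\<^sup>2 +
    (B$1$1 * B$2$2 - (B$1$2)\<^sup>2) * (l$3)\<^sup>2 + 2 * (B$1$3 * B$2$3 - B$1$2 * B$3$3) * (l$1 * l$2) +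
    2 * (B$1$2 * B$2$3 - B$1$3 * B$2$2) * (l$1 * l$3) +
    2 * (B$1$2 * B$1$3 - B$1$1 * B$2$3) * (l$2 * l$3)"

lemma dual_form_scale: "dual_form B (k *s l) = k\<^sup>2 * dual_form B l"
  unfolding dual_form_def vector_smult_component by algebra

text \<open>From adj(B) B = det(B) I, the dual form at \<open>B *v q\<close> is det(B) times the
  form of \<open>B\<close> at \<open>q\<close>, which is zero on the conic.\<close>

lemma dual_form_tangent_line:
  assumes "transpose B = B" "tangent_line B l"
  shows "dual_form B l = 0"
proof -
  obtain q c where q: "on_conic B q" and c: "c \<noteq> 0" "B *v q = c *s l"
    using assms(2) by (auto simp: tangent_line_def proj_eq_def)
  have "dual_form B (B *v q) = det B * scalar_product q (B *v q)"
    unfolding dual_form_def scalar_product_3 matrix_vector_mult_3 det_3 transpose_3[OF assms(1)]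
    by algebra
  then have "c\<^sup>2 * dual_form B l = 0"
    using q by (simp add: on_conic_def c dual_form_scale)
  then show ?thesis using c by simp
qed

text \<open>A zero dual form means that \<open>B\<close> has rank at most 1, and then every point of
  the conic is singular.\<close>

lemma not_tangent_line_if_dual_form_eq_0:
  fixes B :: "'a::field_char_0 ^ 3 ^ 3"
  assumes sym: "transpose B = B" and zero: "\<And>l. dual_form B l = 0"
  shows "\<not> tangent_line B l"
proof
  assume "tangent_line B l"
  then obtain q c where q: "on_conic B q" and c: "l \<noteq> 0" "c \<noteq> 0" "B *v q = c *s l"
    by (auto simp: tangent_line_def proj_eq_def)
  \<comment> \<open>All \<open>2 \<times> 2\<close> minors of \<open>B\<close> vanish, so \<open>(B q)\<^sub>i\<^sup>2\<close> is \<open>B\<^sub>i\<^sub>i\<close> times the value of the form at \<open>q\<close>.\<close>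
  have m1: "B$2$2 * B$3$3 = (B$2$3)\<^sup>2" "B$1$1 * B$3$3 = (B$1$3)\<^sup>2" "B$1$1 * B$2$2 = (B$1$2)\<^sup>2"
    using zero[of "vector [1, 0, 0]"] zero[of "vector [0, 1, 0]"] zero[of "vector [0, 0, 1]"]
    by (simp_all add: dual_form_def)
  \<comment> \<open>At a sum of two unit vectors the square terms vanish by \<open>m1\<close>, which
    leaves twice one mixed coefficient.\<close>
  have m2: "B$1$3 * B$2$3 = B$1$2 * B$3$3" "B$1$2 * B$2$3 = B$1$3 * B$2$2"
    "B$1$2 * B$1$3 = B$1$1 * B$2$3"
    using zero[of "vector [1, 1, 0]"] zero[of "vector [1, 0, 1]"] zero[of "vector [0, 1, 1]"]
    by (simp_all add: dual_form_def m1)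
  have Q: "scalar_product q (B *v q) = 0" using q by (simp add: on_conic_def)
  have "((B *v q)$1)\<^sup>2 = B$1$1 * scalar_product q (B *v q)"
    "((B *v q)$2)\<^sup>2 = B$2$2 * scalar_product q (B *v q)"
    "((B *v q)$3)\<^sup>2 = B$3$3 * scalar_product q (B *v q)"
    unfolding scalar_product_3 matrix_vector_mult_3 transpose_3[OF sym] using m1 m2
    by algebra+
  then have "B *v q = 0"
    by (simp add: Q vec_eq_iff forall_3)
  with c show False by simp
qed

text \<open>Polarization. The mixed term of \<open>l\<close> and \<open>n\<close> is read off from
  \<open>l - n\<close> because, in the application to chords, the difference is a chord over every
  field, while the sum would require a square root of -1.\<close>

lemma dual_form_combination:
  fixes x y z :: "'a::field"
  shows "dual_form B (x *s l + y *s m + z *s n) =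
    x\<^sup>2 * dual_form B l + y\<^sup>2 * dual_form B m + z\<^sup>2 * dual_form B n +
    x * y * (dual_form B (l + m) - dual_form B l - dual_form B m) +
    y * z * (dual_form B (m + n) - dual_form B m - dual_form B n) +
    x * z * (dual_form B l + dual_form B n - dual_form B (l - n))"
  unfolding dual_form_def vector_add_component vector_minus_component vector_smult_component
  by algebra

section \<open>Chords of a parametrized conic\<close>

locale parametrized_conic =
  fixes A :: "'a::field_char_0 ^ 3 ^ 3" and a b c :: "'a ^ 3" and \<phi> :: "'a ^ 2 \<Rightarrow> 'a ^ 3"
  assumes \<phi>: "\<And>v. \<phi> v = (v$1)\<^sup>2 *s a + (v$1 * v$2) *s b + (v$2)\<^sup>2 *s c"
    and nondegenerate: "nondegenerate_conic A"
    and on_conic: "\<And>v. v \<noteq> 0 \<Longrightarrow> on_conic A (\<phi> v)"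
    and inj: "\<And>v w. v \<noteq> 0 \<Longrightarrow> w \<noteq> 0 \<Longrightarrow> proj_eq (\<phi> v) (\<phi> w) \<Longrightarrow> proj_eq v w"
begin

text \<open>The join of \<open>\<phi> v\<close> and \<open>\<phi> w\<close> with its factor
  \<open>bracket v w\<close> divided out. The quotient is symmetric and bilinear, and for v = w it
  is the tangent of the conic.\<close>

definition chord :: "'a ^ 2 \<Rightarrow> 'a ^ 2 \<Rightarrow> 'a ^ 3" where
  "chord v w = (v$1 * w$1) *s vec_cross a b + (v$1 * w$2 + v$2 * w$1) *s vec_cross a c +
    (v$2 * w$2) *s vec_cross b c"

lemma vec_cross_points: "vec_cross (\<phi> v) (\<phi> w) = (v$1 * w$2 - v$2 * w$1) *s chord v w"
  unfolding vec_eq_iff forall_3 vec_cross_nth chord_def \<phi> vector_add_component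
    vector_smult_component
  by (intro conjI; algebra)

text \<open>The vectors \<open>a\<close> and \<open>c\<close> represent the images of (1,0) and
  (0,1), which are distinct points by injectivity.\<close>

lemma endpoints_not_parallel: "vec_cross a c \<noteq> 0"
proof
  assume "vec_cross a c = 0"
  have 1: "\<phi> (vector [1, 0]) = a" "\<phi> (vector [0, 1]) = c"
    by (simp_all add: \<phi>)
  have nz: "(vector [1, 0] :: 'a ^ 2) \<noteq> 0" "(vector [0, 1] :: 'a ^ 2) \<noteq> 0"
    by (simp_all add: vec_eq_iff forall_2)
  have "a \<noteq> 0" "c \<noteq> 0"
    using on_conic[OF nz(1)] on_conic[OF nz(2)] by (simp_all add: on_conic_def 1)
  moreover obtain k where "c = k *s a"
    using vec_cross_eq_0_imp_parallel \<open>a \<noteq> 0\<close> \<open>vec_cross a c = 0\<close> by blast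
  ultimately have "proj_eq a c"
    unfolding proj_eq_def by (intro exI[of _ k]) auto
  then have "proj_eq (vector [1, 0] :: 'a ^ 2) (vector [0, 1])"
    using inj[OF nz] by (simp add: 1)
  then show False
    by (simp add: proj_eq_def vec_eq_iff forall_2)
qed

text \<open>The triple product is, up to sign, the determinant of \<open>a\<close>,
  \<open>b\<close>, \<open>c\<close>. Since it is nonzero, their pairwise cross products span all
  lines.\<close>

lemma coefficients_independent: "scalar_product b (vec_cross a c) \<noteq> 0"
proof
  \<comment> \<open>Otherwise the conic lies on the line through \<open>a\<close> and \<open>c\<close>, and this line is totally isotropic
    for the nondegenerate form \<open>A\<close>.\<close>
  assume dep: "scalar_product b (vec_cross a c) = 0"
  define S where "S x y = scalar_product x (A *v y)" for x y
  have sym: "transpose A = A" and inv: "invertible A"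
    using nondegenerate by (simp_all add: nondegenerate_conic_def is_conic_def)
  have S_sym: "S x y = S y x" for x y
    unfolding S_def by (rule scalar_product_symmetric_matrix[OF sym])
  have S_lin: "S (x + y) z = S x z + S y z" "S z (x + y) = S z x + S z y"
    "S (k *s x) y = k * S x y" "S x (k *s y) = k * S x y" for x y z k
    by (simp_all add: S_def scalar_product_add_left scalar_product_add_right
        scalar_product_scale_left scalar_product_scale_right
        matrix_vector_right_distrib vector_scalar_commute)
  have conic: "s^4 * S a a + 2 * s^3 * t * S a b + s\<^sup>2 * t\<^sup>2 * (2 * S a c + S b b) +
      2 * s * t^3 * S b c + t^4 * S c c = 0" if "s \<noteq> 0 \<or> t \<noteq> 0" for s t
  proof -
    have "(vector [s, t] :: 'a ^ 2) \<noteq> 0"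
      using that by (auto simp: vec_eq_iff forall_2)
    then have "S (\<phi> (vector [s, t])) (\<phi> (vector [s, t])) = 0"
      using on_conic by (simp add: on_conic_def S_def)
    moreover have "S (\<phi> (vector [s, t])) (\<phi> (vector [s, t])) =
      s^4 * S a a + 2 * s^3 * t * S a b + s\<^sup>2 * t\<^sup>2 * (2 * S a c + S b b) +
      2 * s * t^3 * S b c + t^4 * S c c"
      unfolding \<phi> vector_2 S_lin S_sym[of b a] S_sym[of c a] S_sym[of c b] by algebra
    ultimately show ?thesis by simp
  qed
  \<comment> \<open>A binary quartic with five zeros on the projective line has all coefficients
    zero; in characteristic 0 the points (1,0), (0,1), (1,1), (1,-1), (1,2) are distinct.\<close>
  have Saa: "S a a = 0" and Scc: "S c c = 0"
    using conic[of 1 0] conic[of 0 1] by simp_all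
  have e: "2 * S a b + (2 * S a c + S b b) + 2 * S b c = 0"
    "- 2 * S a b + (2 * S a c + S b b) - 2 * S b c = 0"
    "4 * S a b + 4 * (2 * S a c + S b b) + 16 * S b c = 0"
    using conic[of 1 1] conic[of 1 "-1"] conic[of 1 2] by (simp_all add: Saa Scc)
  have "12 * S b c = 0" "12 * S a b = 0" "2 * (2 * S a c + S b b) = 0"
    using e by algebra+
  then have Sbc: "S b c = 0" and Sab: "S a b = 0" and "2 * S a c + S b b = 0"
    by (metis mult_eq_0_iff zero_neq_numeral)+
  then have Sbb: "S b b = - 2 * S a c"
    by algebra
  define n where "n = vec_cross a c"
  have "n \<noteq> 0" using endpoints_not_parallel by (simp add: n_def)
  then have "a \<noteq> 0" by (auto simp: n_def vec_eq_iff forall_3)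
  have "scalar_product n a = 0" "scalar_product n b = 0"
    using dep scalar_product_commute[of n b]
    by (simp_all add: n_def scalar_product_3 algebra_simps)
  then obtain k where "vec_cross a b = k *s n"
    using vec_cross_parallel_if_orthogonal \<open>n \<noteq> 0\<close> by blast
  then have "vec_cross a (b - k *s c) = 0"
    by (simp add: n_def vec_eq_iff forall_3 algebra_simps)
  then obtain h where "b - k *s c = h *s a"
    using vec_cross_eq_0_imp_parallel \<open>a \<noteq> 0\<close> by blast
  then have b: "b = h *s a + k *s c"
    by (metis diff_add_cancel)
  \<comment> \<open>Substituting \<open>b\<close> gives \<open>S a b = k * S a c\<close> and
    \<open>S b b = 2 * h * (k * S a c)\<close>, while \<open>S b b\<close> is also
    \<open>- 2 * S a c\<close>.\<close>
  have "k * S a c = 0"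
    using Sab Saa unfolding b S_lin by simp
  moreover have "2 * h * (k * S a c) = - 2 * S a c"
    using Sbb Saa Scc S_sym[of c a] unfolding b S_lin by (simp add: algebra_simps)
  ultimately have Sac: "S a c = 0" by auto
  have A_nz: "A *v x \<noteq> 0" if "x \<noteq> 0" for x
    using inv that by (metis invertible_def matrix_vector_mul_assoc matrix_vector_mul_lid
        matrix_vector_mult_0_right)
  have "c \<noteq> 0" using \<open>n \<noteq> 0\<close> by (auto simp: n_def vec_eq_iff forall_3)
  \<comment> \<open>The polar lines of \<open>a\<close> and \<open>c\<close> both pass through
    \<open>a\<close> and \<open>c\<close>, so \<open>n\<close> is a multiple of each. Injectivity of
    \<open>A\<close> then makes \<open>a\<close> and \<open>c\<close> proportional, contradicting
    \<open>n \<noteq> 0\<close>.\<close>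
  have orth: "scalar_product (A *v a) a = 0" "scalar_product (A *v a) c = 0"
    "scalar_product (A *v c) a = 0" "scalar_product (A *v c) c = 0"
    using Saa Sac Scc S_sym[of c a]
    by (simp_all add: S_def scalar_product_commute[of "A *v _"])
  obtain r where r: "n = r *s (A *v a)"
    using vec_cross_parallel_if_orthogonal[OF A_nz[OF \<open>a \<noteq> 0\<close>] orth(1,2)] n_def by blast
  obtain s where s: "n = s *s (A *v c)"
    using vec_cross_parallel_if_orthogonal[OF A_nz[OF \<open>c \<noteq> 0\<close>] orth(3,4)] n_def by blast
  have "A *v (r *s a - s *s c) = 0"
    using r s by (simp add: matrix_vector_mult_diff_distrib vector_scalar_commute)
  then have rs: "r *s a = s *s c"
    using A_nz by force
  have "r \<noteq> 0" using r \<open>n \<noteq> 0\<close> by auto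
  have "r *s n = vec_cross (r *s a) c"
    by (simp add: n_def vec_eq_iff forall_3 algebra_simps)
  also have "\<dots> = 0"
    unfolding rs by (simp add: vec_eq_iff forall_3)
  finally have "r *s n = 0" .
  then show False using \<open>r \<noteq> 0\<close> \<open>n \<noteq> 0\<close> by simp
qed

text \<open>Six chords supply the six values from which polarization computes the dual form on the
  span of the three cross products, and this span contains every line.\<close>

lemma dual_form_eq_0_if_chords:
  assumes "\<And>v w. dual_form B (chord v w) = 0"
  shows "dual_form B l = 0"
proof -
  have "dual_form B (vec_cross a b) = 0" "dual_form B (vec_cross a c) = 0"
    "dual_form B (vec_cross b c) = 0" "dual_form B (vec_cross a b + vec_cross a c) = 0"
    "dual_form B (vec_cross a c + vec_cross b c) = 0"
    "dual_form B (vec_cross a b - vec_cross b c) = 0"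
    using assms[of "vector [1, 0]" "vector [1, 0]"] assms[of "vector [1, 0]" "vector [0, 1]"]
      assms[of "vector [0, 1]" "vector [0, 1]"] assms[of "vector [1, 0]" "vector [1, 1]"]
      assms[of "vector [1, 1]" "vector [0, 1]"] assms[of "vector [1, 1]" "vector [1, -1]"]
    by (simp_all add: chord_def)
  then have span: "dual_form B (x *s vec_cross a b + y *s vec_cross a c + z *s vec_cross b c) = 0"
    for x y z
    unfolding dual_form_combination by simp
  \<comment> \<open>This is the determinant of \<open>a\<close>, \<open>b\<close>, \<open>c\<close>;
    the identity below expands \<open>l\<close> in the basis dual to them, scaled by
    \<open>d\<close>.\<close>
  define d where "d = - scalar_product b (vec_cross a c)"
  have "d *s l = scalar_product l c *s vec_cross a b + (- scalar_product l b) *s vec_cross a c +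
      scalar_product l a *s vec_cross b c"
    unfolding d_def vec_eq_iff forall_3 scalar_product_3 vec_cross_nth vector_add_component
      vector_smult_component
    by (intro conjI; algebra)
  then have "d\<^sup>2 * dual_form B l = 0"
    using span dual_form_scale by metis
  then show ?thesis using coefficients_independent by (simp add: d_def)
qed

lemma chord_commute: "chord v w = chord w v"
  by (simp add: chord_def algebra_simps)

lemma binary_quadratic_dual_form_chord: "binary_quadratic (\<lambda>w. dual_form B (chord v w))"
proof -
  define m n where "m = v$1 *s vec_cross a b + v$2 *s vec_cross a c"
    and "n = v$1 *s vec_cross a c + v$2 *s vec_cross b c"
  have "chord v w = w$1 *s m + w$2 *s n" for w
    by (simp add: chord_def m_def n_def vec_eq_iff algebra_simps)
  then have "dual_form B (chord v w) = dual_form B m * (w$1)\<^sup>2 +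
      (dual_form B (m + n) - dual_form B m - dual_form B n) * (w$1 * w$2) +
      dual_form B n * (w$2)\<^sup>2" for w
    using dual_form_combination[of B "w$1" m "w$2" n 0 0] by (simp add: algebra_simps)
  then show ?thesis
    unfolding binary_quadratic_def by blast
qed

text \<open>Both points lie on \<open>l\<close>, so the chord is a multiple of \<open>l\<close>, and
  the dual form vanishes on tangents.\<close>

lemma dual_form_chord_if_tangent:
  assumes "transpose B = B" "tangent_line B l" "incident x l" "incident y l"
    and "proj_eq (\<phi> v) x" "proj_eq (\<phi> w) y" "bracket v w \<noteq> 0"
  shows "dual_form B (chord v w) = 0"
proof -
  have "l \<noteq> 0" "scalar_product l (\<phi> v) = 0" "scalar_product l (\<phi> w) = 0"
    using assms(3-6)
    by (auto simp: incident_def proj_eq_def scalar_product_scale_right)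
  then obtain k where "vec_cross (\<phi> v) (\<phi> w) = k *s l"
    using vec_cross_parallel_if_orthogonal by blast
  then have "bracket v w *s chord v w = k *s l"
    by (simp add: vec_cross_points bracket_eq)
  then have "(bracket v w)\<^sup>2 * dual_form B (chord v w) = k\<^sup>2 * dual_form B l"
    by (metis dual_form_scale)
  then show ?thesis
    using dual_form_tangent_line[OF assms(1,2)] assms(7) by simp
qed

end

section \<open>From the Poncelet octagon to the bracket equation\<close>

lemma proj_eq_sym: "proj_eq x y \<Longrightarrow> proj_eq y x"
  unfolding proj_eq_def
  by (metis left_inverse nonzero_imp_inverse_nonzero vector_smult_assoc vector_smult_lid)

lemma proj_eq_trans: "proj_eq x y \<Longrightarrow> proj_eq y z \<Longrightarrow> proj_eq x z"
  unfolding proj_eq_def by (metis mult_eq_0_iff vector_smult_assoc)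

theorem theorem4:
  fixes A B :: "'a::real_normed_field ^ 3 ^ 3"
    and p :: "nat \<Rightarrow> 'a ^ 3"
    and \<phi> :: "'a ^ 2 \<Rightarrow> 'a ^ 3"
    and v :: "nat \<Rightarrow> 'a ^ 2"
  assumes "nondegenerate_conic A"
    and "is_conic B"
    and "proper_poncelet_octagon A B p"
    and "conic_parametrization A \<phi>"
    and "\<forall>i\<in>{1..8}. v i \<noteq> 0 \<and> proj_eq (\<phi> (v i)) (p i)"
  shows "bracket (v 1) (v 2) * bracket (v 1) (v 4) * bracket (v 2) (v 7) *
         bracket (v 3) (v 4) * bracket (v 3) (v 5) * bracket (v 5) (v 7) =
         bracket (v 1) (v 3) * bracket (v 1) (v 7) * bracket (v 2) (v 3) *
         bracket (v 2) (v 5) * bracket (v 4) (v 5) * bracket (v 4) (v 7)"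
proof -
  obtain a b c where \<phi>: "\<And>v. \<phi> v = (v $ 1)\<^sup>2 *s a + (v $ 1 * v $ 2) *s b + (v $ 2)\<^sup>2 *s c"
    using assms(4) by (auto simp: conic_parametrization_def)
  interpret parametrized_conic A a b c \<phi>
    using assms(1,4) \<phi> by unfold_locales (auto simp: conic_parametrization_def)
  have sym: "transpose B = B"
    using assms(2) by (simp add: is_conic_def)
  obtain l where l: "\<And>i. i \<ge> 1 \<Longrightarrow>
      tangent_line B (l i) \<and> incident (p i) (l i) \<and> incident (p (i + 1)) (l i)"
    using assms(3)
    unfolding proper_poncelet_octagon_def poncelet_octagon_def poncelet_chain_def by blast
  have period: "proj_eq (p 9) (p 1)"
    using assms(3) unfolding proper_poncelet_octagon_def poncelet_octagon_def
    by (auto dest!: spec[of _ 1])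
  have p_ne: "\<not> proj_eq (p i) (p j)" if "i \<in> {1..8}" "j \<in> {1..8}" "i \<noteq> j" for i j
    using assms(3) that unfolding proper_poncelet_octagon_def by blast
  have v: "v i \<noteq> 0" "proj_eq (\<phi> (v i)) (p i)" if "i \<in> {1..8}" for i
    using assms(5) that by blast+
  have bracket_nz: "bracket (v i) (v j) \<noteq> 0" if ij: "i \<in> {1..8}" "j \<in> {1..8}" "i \<noteq> j" for i j
  proof
    assume "bracket (v i) (v j) = 0"
    then obtain k where k: "k \<noteq> 0" "v j = k *s v i"
      using bracket_eq_0_imp_proj_eq v ij by (metis proj_eq_def)
    \<comment> \<open>The map \<open>\<phi>\<close> is homogeneous of degree 2, so proportional
      parameters give the same point.\<close>
    have "\<phi> (v j) = k\<^sup>2 *s \<phi> (v i)"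
      unfolding \<phi> k(2) by (simp add: vec_eq_iff power2_eq_square algebra_simps)
    then have "proj_eq (\<phi> (v i)) (\<phi> (v j))"
      using k(1) unfolding proj_eq_def by (intro exI[of _ "k\<^sup>2"]) simp
    then have "proj_eq (p i) (p j)"
      using v ij by (meson proj_eq_sym proj_eq_trans)
    then show False using p_ne ij by blast
  qed
  \<comment> \<open>Parameters are given for the indices 1 to 8 only; periodicity lets
    \<open>v 1\<close> represent the end \<open>p 9\<close> of the last side.\<close>
  have next_point: "incident (p (i + 1)) (l i) \<and> proj_eq (\<phi> (v (octagon_succ i))) (p (i + 1))"
    if i: "i \<in> {1..8}" for i
  proof (cases "i = 8")
    case True
    then show ?thesis
      using l[of 8] proj_eq_trans[OF v(2)[of 1] proj_eq_sym[OF period]] by (auto simp: octagon_succ_def)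
  next
    case False
    then show ?thesis
      using l[of i] v(2)[of "i + 1"] i by (simp add: octagon_succ_def)
  qed
  \<comment> \<open>The tangent \<open>l 1\<close> exists, so the dual form is not zero, and some
    chord detects this.\<close>
  have "\<exists>x y. dual_form B (chord x y) \<noteq> 0"
    using dual_form_eq_0_if_chords not_tangent_line_if_dual_form_eq_0[OF sym] l[of 1] by blast
  then obtain x y where "dual_form B (chord x y) \<noteq> 0" by blast
  then show ?thesis
  proof (rule symmetric_biquadratic_octagon[where F = "\<lambda>x y. dual_form B (chord x y)", rotated 2])
    fix i :: nat
    assume i: "i \<in> {1..8}"
    then have "octagon_succ i \<in> {1..8}" "i \<noteq> octagon_succ i"
      by (auto simp: octagon_succ_def)
    then show "dual_form B (chord (v i) (v (octagon_succ i))) = 0"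
      using i l[of i] v(2)[of i] next_point[OF i] bracket_nz sym
      by (intro dual_form_chord_if_tangent[of B "l i" "p i" "p (i + 1)"]) auto
  qed (auto simp: chord_commute bracket_nz binary_quadratic_dual_form_chord)
qed

end
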